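(* Let $\Omega\subset\mathbb{R}^2$ be a domain. Then $\Omega$ is homotopically $(1,C)$-bounded turning for some $C\ge 1$ if and only if it is homologically $(1,C')$-bounded turning for some $C'\ge 1$, quantitatively: each of the constants $C$, $C'$ can be chosen depending only on the other (and not on $\Omega$).
   Context: A domain is a nonempty connected open set. $\Omega$ is homotopically $(1,C)$-bounded turning if every continuous map $f:\mathbb{S}^1\to\Omega$ has a continuous extension $g:\overline{\mathbb{B}}^{2}\to\Omega$ to the closed unit disk with $\operatorname{diam}(g(\overline{\mathbb{B}}^{2}))\le C\operatorname{diam}(f(\mathbb{S}^1))$. $\Omega$ is homologically $(1,C)$-bounded turning if each singular $1$-cycle $z$ in $\Omega$ (coefficients in $\mathbb{Z}$) bounds a singular $2$-chain $g$ in $\Omega$ with $\operatorname{diam}(|g|)\le C\operatorname{diam}(|z|)$, where $|\cdot|$ denotes the support (union of images of the simplices occurring) of a chain. *)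

theory Defs
  imports "HOL-Homology.Homology"
begin

definition is_domain :: "'a::topological_space set \<Rightarrow> bool" where
  "is_domain \<Omega> \<longleftrightarrow> open \<Omega> \<and> connected \<Omega> \<and> \<Omega> \<noteq> {}"

definition homotopically_1_bounded_turning :: "real \<Rightarrow> 'a::metric_space set \<Rightarrow> bool" where
  "homotopically_1_bounded_turning C \<Omega> \<longleftrightarrow>
    (\<forall>f :: real^2 \<Rightarrow> 'a.
        continuous_on (sphere 0 1) f \<and> f ` sphere 0 1 \<subseteq> \<Omega> \<longrightarrow>
        (\<exists>g :: real^2 \<Rightarrow> 'a.
            continuous_on (cball 0 1) g \<and> g ` cball 0 1 \<subseteq> \<Omega> \<and>
            (\<forall>x\<in>sphere 0 1. g x = f x) \<and>
            diameter (g ` cball 0 1) \<le> C * diameter (f ` sphere 0 1)))"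

text \<open>A \<open>p\<close>-chain is an integer combination of maps, and its \<open>keys\<close> are the simplices
  occurring with nonzero coefficient. The zero chain has empty support, of diameter \<open>0\<close>.\<close>

definition chain_support :: "nat \<Rightarrow> 'a chain \<Rightarrow> 'a set" where
  "chain_support p c = (\<Union>s\<in>Poly_Mapping.keys c. s ` standard_simplex p)"

text \<open>Cycles relative to the empty set are the absolute cycles (see \<open>singular_cycle\<close>).\<close>

definition homologically_1_bounded_turning :: "real \<Rightarrow> 'a::metric_space set \<Rightarrow> bool" where
  "homologically_1_bounded_turning C \<Omega> \<longleftrightarrow>
    (\<forall>z. singular_relcycle 1 (top_of_set \<Omega>) {} z \<longrightarrow>
        (\<exists>g. singular_chain 2 (top_of_set \<Omega>) g \<and> chain_boundary 2 g = z \<and>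
            diameter (chain_support 2 g) \<le> C * diameter (chain_support 1 z)))"

end

theory Submission
  imports Defs "HOL-Complex_Analysis.Complex_Analysis"
begin

text \<open>
  Both conditions say that \<open>\<Omega>\<close> is simply connected, and both then hold with the constant \<open>3\<close>.
  If \<open>\<Omega>\<close> is simply connected and \<open>B\<close> is the ball of radius \<open>3d/2\<close> about a point of a set of
  diameter \<open>d\<close>, then winding numbers show that all components of \<open>\<Omega> \<inter> B\<close> are simply connected, hence
  contractible by the Riemann mapping theorem, so that loops and cycles of diameter \<open>d\<close> can be
  filled inside \<open>\<Omega> \<inter> B\<close>. Conversely, if \<open>z \<notin> \<Omega>\<close>, the winding number about \<open>z\<close> extends additively to
  singular \<open>1\<close>-chains of \<open>\<Omega>\<close> and vanishes on boundaries, so if every cycle bounds, then all winding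
  numbers of loops about points outside \<open>\<Omega>\<close> vanish.
\<close>

section \<open>Components of intersections of simply connected open sets in the plane\<close>

text \<open>A loop in \<open>C\<close> lies in both \<open>S\<close> and \<open>T\<close>, so it has
  winding number zero about any point missing from either of them. Only points of other components
  of \<open>S \<inter> T\<close> remain, and the winding number there is compared with its value at
  a frontier point.\<close>

lemma simply_connected_components_Int:
  fixes S T :: "complex set"
  assumes "open S" "open T" "simply_connected S" "simply_connected T"
    and C: "C \<in> components (S \<inter> T)"
  shows "simply_connected C"
proof -
  have openC: "open C"
    using C assms open_components by blast
  have connC: "connected C" and CST: "C \<subseteq> S \<inter> T"
    using in_components_connected[OF C] in_components_subset[OF C] by auto
  have "winding_number g z = 0"
    if g: "path g" "path_image g \<subseteq> C" "pathfinish g = pathstart g" and z: "z \<notin> C" for g z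
  proof -
    have outer: "winding_number g w = 0" if "w \<notin> S \<inter> T" for w
      using that g CST assms simply_connected_eq_winding_number_zero by (metis IntI le_inf_iff order_trans)
    show ?thesis
    proof (cases "z \<in> S \<inter> T")
      \<comment> \<open>The winding number is constant on the closure of another component, whose frontier avoids \<open>S \<inter> T\<close>.\<close>
      case True
      define D where "D = connected_component_set (S \<inter> T) z"
      have D: "D \<in> components (S \<inter> T)" "z \<in> D"
        using True by (auto simp: D_def componentsI)
      then have CD: "C \<inter> D = {}"
        using C z components_nonoverlap by metis
      then have "D \<noteq> UNIV"
        using in_components_nonempty[OF C] by auto
      then obtain w where w: "w \<in> frontier D"
        using D(2) frontier_eq_empty by blast
      have "w \<notin> S \<inter> T"
        using w frontier_of_components_subset[OF D(1)] frontier_disjoint_eq open_Int assms by blast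
      \<comment> \<open>The open set \<open>C\<close> is disjoint from \<open>D\<close>, hence also
        from \<open>closure D\<close>, so the winding number is defined on all of this
        closure.\<close>
      moreover have "closure D \<inter> path_image g = {}"
        using CD openC g(2) open_Int_closure_eq_empty by blast
      moreover have "connected (closure D)"
        using D(1) connected_imp_connected_closure in_components_connected by blast
      ultimately show ?thesis
        using winding_number_eq[OF g(1,3), of z "closure D" w] outer D(2) w
        by (metis closure_subset frontier_def DiffD1 subsetD)
    qed (use outer in auto)
  qed
  then show ?thesis
    using connC openC simply_connected_eq_winding_number_zero by blast
qed

lemma homeomorphism_image_components:
  assumes h: "homeomorphism S T f g" and C: "C \<in> components S"
  shows "f ` C \<in> components T"
proof -
  obtain x where x: "x \<in> S" and Cx: "C = connected_component_set S x"
    using C by (auto simp: components_def)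
  let ?D = "connected_component_set T (f x)"
  have fx: "f x \<in> T" and CS: "C \<subseteq> S"
    using h x C homeomorphism_image1 in_components_subset by fast+
  have "connected (f ` C)" "connected (g ` ?D)"
    using h C CS by (meson connected_connected_component connected_component_subset
        connected_continuous_image continuous_on_subset homeomorphism_cont1 homeomorphism_cont2
        in_components_connected)+
  moreover have "f ` C \<subseteq> T" "g ` ?D \<subseteq> S"
    using h CS connected_component_subset homeomorphism_image1 homeomorphism_image2 by blast+
  moreover have "f x \<in> f ` C"
    using x Cx by simp
  moreover have "x \<in> g ` ?D"
    using x fx h by (metis connected_component_refl homeomorphism_apply1 imageI mem_Collect_eq)
  ultimately have "f ` C \<subseteq> ?D" "g ` ?D \<subseteq> C"
    unfolding Cx by (simp_all add: connected_component_maximal)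
  moreover have "f ` g ` ?D = ?D"
    using h connected_component_subset[of T "f x"] by (force simp: homeomorphism_def image_iff)
  ultimately have "f ` C = ?D"
    by blast
  then show ?thesis
    using fx componentsI by metis
qed

text \<open>Winding numbers and the Riemann mapping theorem live on \<open>complex\<close>; a linear
  isometry carries their consequences to any two-dimensional Euclidean space. Preservation of the
  norm ensures that unit circles and disks correspond.\<close>

lemma planar_homeomorphism:
  assumes "DIM('a::euclidean_space) = 2"
  obtains f :: "'a::euclidean_space \<Rightarrow> complex" and g where "homeomorphism UNIV UNIV f g"
    "\<And>x. norm (f x) = norm x" "\<And>y. norm (g y) = norm y"
proof -
  obtain f :: "'a \<Rightarrow> complex" and g where fg: "linear f" "linear g"
    "\<And>x. norm (f x) = norm x" "\<And>y. norm (g y) = norm y" "\<And>x. g (f x) = x" "\<And>y. f (g y) = y"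
    using isomorphisms_UNIV_UNIV[where 'M='a and 'N=complex] assms by auto
  have "surj f" "surj g"
    using fg(5,6) by (metis surjI)+
  moreover have "continuous_on UNIV f" "continuous_on UNIV g"
    using fg(1,2) by (simp_all add: linear_continuous_on linear_linear)
  ultimately have "homeomorphism UNIV UNIV f g"
    using fg(5,6) by (simp add: homeomorphism_def)
  then show ?thesis
    using that fg(3,4) by metis
qed

text \<open>The preceding result is transported from \<open>complex\<close>, where simply connected
  open sets are contractible. Contractibility is what makes the homology of each component
  vanish.\<close>

lemma planar_contractible_components_Int:
  fixes S T :: "'a::euclidean_space set"
  assumes dim: "DIM('a) = 2" and "open S" "open T" "simply_connected S" "simply_connected T"
    and C: "C \<in> components (S \<inter> T)"
  shows "contractible C"
proof -
  obtain f :: "'a \<Rightarrow> complex" and g where h: "homeomorphism UNIV UNIV f g"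
    using planar_homeomorphism[OF dim] by metis
  have hU: "homeomorphism U (f ` U) f g" for U
    using homeomorphism_of_subsets[OF h] by blast
  have op: "open (f ` U)" if "open U" for U
    using homeomorphism_imp_open_map[OF h] that by simp
  have sc: "simply_connected (f ` U)" if "simply_connected U" for U
    using that hU homeomorphic_def homeomorphic_simply_connected_eq by metis
  have "inj f"
    using h by (metis UNIV_I homeomorphism_apply1 injI)
  then have fC: "f ` C \<in> components (f ` S \<inter> f ` T)"
    using homeomorphism_image_components[OF hU C] by (simp add: image_Int)
  then have "simply_connected (f ` C)"
    using simply_connected_components_Int op sc assms by metis
  moreover have "open (f ` C)"
    using fC op assms open_components by blast
  ultimately have "contractible (f ` C)"
    using contractible_eq_simply_connected_2d by blast
  then show ?thesis
    using hU homeomorphic_def homeomorphic_contractible_eq by metis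
qed

section \<open>Vanishing homology and supports of chains\<close>

text \<open>Homology classes are sets of homologous chains, and the identity class is the set of
  boundaries. In a trivial group the class of \<open>z\<close>, which contains \<open>z\<close>, is
  that set.\<close>

lemma homologically_trivial_imp_boundary:
  assumes "trivial_group (homology_group (int p) X)" "singular_relcycle p X {} z"
  shows "singular_relboundary p X {} z"
proof -
  have "homologous_rel_set p X {} z \<in> carrier (homology_group (int p) X)"
    using assms(2) by (simp add: carrier_relative_homology_group)
  then have "homologous_rel_set p X {} z = singular_relboundary_set p X {}"
    using assms(1) by (simp add: trivial_group_def)
  then show ?thesis
    by (metis homologous_rel_refl mem_Collect_eq)
qed

lemma trivial_homology_group_contractible_space:
  assumes "contractible_space X" "p \<noteq> 0"
  shows "trivial_group (homology_group p X)"
  using trivial_reduced_homology_group_contractible_space[OF assms(1), of p] assms(2)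
  by (simp add: un_reduced_homology_group)

text \<open>Homology is additive over the open components, and each summand vanishes away from
  degree zero. All components are treated together because the support of a cycle may meet several
  of them.\<close>

lemma trivial_homology_group_contractible_components:
  fixes S :: "'a::real_normed_vector set"
  assumes "open S" "\<And>C. C \<in> components S \<Longrightarrow> contractible C" "p \<noteq> 0"
  shows "trivial_group (homology_group p (top_of_set S))"
proof -
  let ?G = "\<lambda>C. homology_group p (subtopology (top_of_set S) C)"
  have triv: "trivial_group (?G C)" if "C \<in> components S" for C
  proof -
    have "subtopology (top_of_set S) C = top_of_set C"
      using in_components_subset[OF that] by (simp add: subtopology_subtopology inf.absorb2)
    then show ?thesis
      using assms that by (simp add: trivial_homology_group_contractible_space)
  qed
  have "sum_group (components S) ?G \<cong> homology_group p (top_of_set S)"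
  proof (rule is_isoI, rule homology_additivity_axiom)
    show "openin (top_of_set S) C" if "C \<in> components S" for C
      using that assms(1) open_components in_components_subset openin_open_eq by metis
  qed (simp_all add: pairwise_disjoint_components disjnt_def pairwise_def components_nonoverlap)
  moreover have "trivial_group (sum_group (components S) ?G)"
  proof -
    let ?SG = "sum_group (components S) ?G"
    have "group ?SG"
      by simp
    moreover have "x = \<one>\<^bsub>?SG\<^esub>" if "x \<in> carrier ?SG" for x
    proof -
      have x: "x \<in> (\<Pi>\<^sub>E C\<in>components S. carrier (?G C))"
        using that by (simp add: carrier_sum_group)
      have "x C = (\<lambda>C\<in>components S. \<one>\<^bsub>?G C\<^esub>) C" for C
      proof (cases "C \<in> components S")
        case True
        then have "x C \<in> {\<one>\<^bsub>?G C\<^esub>}"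
          using PiE_mem[OF x True] triv[OF True] unfolding trivial_group_def by blast
        then show ?thesis
          using True by simp
      qed (simp add: PiE_arb[OF x])
      then show ?thesis
        by (simp add: fun_eq_iff)
    qed
    ultimately show ?thesis
      unfolding trivial_group_def using group.is_monoid monoid.one_closed by fast
  qed
  ultimately show ?thesis
    by (meson group_relative_homology_group isomorphic_group_triviality1)
qed

text \<open>Compactness gives boundedness, without which the diameter need not bound distances
  between points of the support.\<close>

lemma compact_chain_support:
  fixes X :: "'a::topological_space set"
  assumes "singular_chain p (top_of_set X) c"
  shows "compact (chain_support p c)" "chain_support p c \<subseteq> X"
proof -
  have "continuous_on (standard_simplex p) s \<and> s ` standard_simplex p \<subseteq> X"
    if "s \<in> Poly_Mapping.keys c" for s
  proof -
    have "singular_simplex p (top_of_set X) s"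
      using assms that by (auto simp: singular_chain_def)
    then show ?thesis
      by (auto simp: singular_simplex_def euclidean_product_topology)
  qed
  moreover have "compact (standard_simplex p)"
    using compactin_standard_simplex[of p] by (simp add: euclidean_product_topology)
  ultimately show "compact (chain_support p c)" "chain_support p c \<subseteq> X"
    unfolding chain_support_def by (auto intro!: compact_UN compact_continuous_image)
qed

text \<open>The boundary operator does not refer to the ambient space, so a cycle may be regarded
  inside any set that contains its support.\<close>

lemma singular_cycle_chain_support:
  assumes "singular_relcycle p (top_of_set X) {} z" "chain_support p z \<subseteq> Y"
  shows "singular_relcycle p (top_of_set Y) {} z"
proof -
  have "singular_chain p (subtopology euclidean X) z"
    using assms(1) by (simp add: singular_cycle)
  then have "singular_chain p (top_of_set Y) z"
    using assms(2) unfolding singular_chain_def singular_simplex_def chain_support_def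
    by (fastforce simp: euclidean_product_topology)
  then show ?thesis
    using assms(1) by (simp add: singular_cycle)
qed

lemma diameter_subset_ball:
  fixes p :: "'a::real_normed_vector"
  assumes "S \<subseteq> ball p r" "0 \<le> r"
  shows "diameter S \<le> 2 * r"
proof (rule diameter_le)
  fix x y assume "x \<in> S" "y \<in> S"
  then have "dist p x < r" "dist p y < r"
    using assms by auto
  then have "dist x y \<le> 2 * r"
    by (smt (verit) dist_triangle3)
  then show "norm (x - y) \<le> 2 * r"
    by (simp add: dist_norm)
qed (use assms in auto)

section \<open>Fillings with controlled diameter in simply connected domains\<close>

lemma simply_connected_imp_homologically:
  fixes \<Omega> :: "'a::euclidean_space set"
  assumes dim: "DIM('a) = 2" and "open \<Omega>" "simply_connected \<Omega>"
  shows "homologically_1_bounded_turning 3 \<Omega>"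
  unfolding homologically_1_bounded_turning_def
proof (intro allI impI)
  fix z :: "'a chain"
  assume z: "singular_relcycle 1 (top_of_set \<Omega>) {} z"
  define K where "K = chain_support 1 z"
  have K: "compact K" "K \<subseteq> \<Omega>"
    using compact_chain_support[of 1 \<Omega> z] z by (simp_all add: K_def singular_cycle)
  have "\<exists>V. K \<subseteq> V \<and> V \<subseteq> \<Omega> \<and> trivial_group (homology_group 1 (top_of_set V))
          \<and> (\<forall>S \<subseteq> V. diameter S \<le> 3 * diameter K)"
  \<comment> \<open>For diameter zero the ball used below would be empty. Here \<open>K\<close> has
    at most one point and can itself serve as \<open>V\<close>.\<close>
  proof (cases "diameter K = 0")
    case True
    have "K = {} \<or> (\<exists>a. K = {a})"
      using diameter_bounded_bound[OF compact_imp_bounded[OF K(1)]] True by fastforce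
    then have "contractible K" "\<forall>S \<subseteq> K. diameter S \<le> 3 * diameter K"
      by (auto simp: subset_singleton_iff)
    then show ?thesis
      using K by (intro exI[of _ K]) (simp add: trivial_homology_group_contractible_space)
  next
    case False
    then obtain a where a: "a \<in> K" and d: "diameter K > 0"
      using K(1) by (metis compact_imp_bounded diameter_empty diameter_ge_0 ex_in_conv less_eq_real_def)
    \<comment> \<open>A factor above 1 puts all of \<open>K\<close> inside the open ball; twice the
      radius gives the constant 3.\<close>
    let ?B = "ball a (3/2 * diameter K)"
    have "K \<subseteq> ?B"
      using diameter_bounded_bound[OF compact_imp_bounded[OF K(1)] a] d by fastforce
    moreover have "trivial_group (homology_group 1 (top_of_set (\<Omega> \<inter> ?B)))"
      using planar_contractible_components_Int[OF dim assms(2) open_ball assms(3)] assms(2)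
      by (intro trivial_homology_group_contractible_components)
        (auto intro: convex_imp_simply_connected)
    moreover have "diameter S \<le> 3 * diameter K" if "S \<subseteq> \<Omega> \<inter> ?B" for S
      using diameter_subset_ball[of S a "3/2 * diameter K"] that d by simp
    ultimately show ?thesis
      using K by (intro exI[of _ "\<Omega> \<inter> ?B"]) auto
  qed
  then obtain V where V: "K \<subseteq> V" "V \<subseteq> \<Omega>" "trivial_group (homology_group 1 (top_of_set V))"
    "\<And>S. S \<subseteq> V \<Longrightarrow> diameter S \<le> 3 * diameter K"
    by blast
  have "singular_relboundary 1 (top_of_set V) {} z"
    using homologically_trivial_imp_boundary[of 1 "top_of_set V" z] V(1,3)
      singular_cycle_chain_support[OF z, of V] by (simp add: K_def)
  then obtain g where g: "singular_chain 2 (top_of_set V) g" "chain_boundary 2 g = z"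
    by (auto simp: singular_boundary numeral_2_eq_2)
  then show "\<exists>g. singular_chain 2 (top_of_set \<Omega>) g \<and> chain_boundary 2 g = z \<and>
            diameter (chain_support 2 g) \<le> 3 * diameter (chain_support 1 z)"
    using V(2,4) compact_chain_support[OF g(1)] singular_chain_mono K_def by metis
qed

text \<open>Circle maps into a simply connected set are null-homotopic, and a null-homotopy is the
  same as an extension over the disk. The maps \<open>h\<close> and \<open>k\<close> pass between
  \<open>'b\<close> and \<open>complex\<close>, where the circle criterion is formulated.\<close>

lemma simply_connected_circle_extension:
  fixes f :: "'b::euclidean_space \<Rightarrow> 'a::real_normed_vector"
  assumes dim: "DIM('b) = 2" and V: "simply_connected V"
    and f: "continuous_on (sphere 0 1) f" "f ` sphere 0 1 \<subseteq> V"
  obtains g where "continuous_on (cball 0 1) g" "g ` cball 0 1 \<subseteq> V" "\<And>x. x \<in> sphere 0 1 \<Longrightarrow> g x = f x"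
proof -
  obtain h :: "'b \<Rightarrow> complex" and k where h: "homeomorphism UNIV UNIV h k"
    "\<And>x. norm (h x) = norm x" "\<And>y. norm (k y) = norm y"
    using planar_homeomorphism[OF dim] by metis
  have cont: "continuous_on U h" "continuous_on W k" for U W
    using h(1) continuous_on_subset by (auto simp: homeomorphism_def)
  have "continuous_on (sphere 0 1) (f \<circ> k)"
    using f(1) cont h(3) by (intro continuous_on_compose) (auto elim!: continuous_on_subset)
  moreover have im: "(f \<circ> k) ` sphere 0 1 \<subseteq> V"
    using f(2) h(3) by fastforce
  moreover obtain a where "a \<in> V"
    using im by (force dest: subsetD[of _ V "f (k 1)"] intro: imageI)
  ultimately have "homotopic_with_canon (\<lambda>h. True) (sphere 0 1) V (f \<circ> k) (\<lambda>x. a)"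
    by (intro simply_connected_eq_homotopic_circlemaps1[OF V]) (auto intro: continuous_on_const)
  then obtain g where g: "continuous_on (cball 0 1) g" "g ` cball 0 1 \<subseteq> V"
    "\<And>x. x \<in> sphere 0 1 \<Longrightarrow> g x = (f \<circ> k) x"
    using nullhomotopic_from_sphere_extension[of 0 1 V "f \<circ> k"] by metis
  show thesis
  proof
    show "continuous_on (cball 0 1) (g \<circ> h)"
      using g(1) cont h(2) by (intro continuous_on_compose) (auto elim!: continuous_on_subset)
    show "(g \<circ> h) ` cball 0 1 \<subseteq> V"
      using g(2) h(2) by fastforce
    show "(g \<circ> h) x = f x" if "x \<in> sphere 0 1" for x
      using that g(3) h by (simp add: homeomorphism_def)
  qed
qed

lemma simply_connected_imp_homotopically:
  fixes \<Omega> :: "'a::euclidean_space set"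
  assumes dim: "DIM('a) = 2" and "open \<Omega>" "simply_connected \<Omega>"
  shows "homotopically_1_bounded_turning 3 \<Omega>"
  unfolding homotopically_1_bounded_turning_def
proof (intro allI impI)
  fix f :: "real^2 \<Rightarrow> 'a"
  assume f: "continuous_on (sphere 0 1) f \<and> f ` sphere 0 1 \<subseteq> \<Omega>"
  define K where "K = f ` sphere 0 1"
  have K: "compact K" "connected K" "K \<subseteq> \<Omega>"
    using f by (auto simp: K_def compact_continuous_image connected_sphere connected_continuous_image)
  obtain a where a: "a \<in> K"
    using vector_choose_size[of 1, where 'a="real^2"] by (force simp: K_def)
  have dist: "dist x y \<le> diameter K" if "x \<in> K" "y \<in> K" for x y
    using that K(1) compact_imp_bounded diameter_bounded_bound by blast
  have "\<exists>V. K \<subseteq> V \<and> V \<subseteq> \<Omega> \<and> simply_connected V \<and> (\<forall>S \<subseteq> V. diameter S \<le> 3 * diameter K)"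
  proof (cases "diameter K = 0")
    case True
    then have "K = {a}"
      using dist a by fastforce
    then show ?thesis
      using K by (intro exI[of _ "{a}"]) (auto simp: subset_singleton_iff convex_imp_simply_connected)
  next
    case False
    then have d: "diameter K > 0"
      using K(1) by (metis compact_imp_bounded diameter_ge_0 less_eq_real_def)
    let ?U = "\<Omega> \<inter> ball a (3/2 * diameter K)"
    \<comment> \<open>The image of a loop is connected, in contrast to the support of a cycle, so a
      single component contains it.\<close>
    define C where "C = connected_component_set ?U a"
    have KU: "K \<subseteq> ?U"
      using K(3) dist[OF a] d by fastforce
    then have "C \<in> components ?U"
      using a componentsI unfolding C_def by blast
    then have "simply_connected C"
      using planar_contractible_components_Int[OF dim assms(2) open_ball assms(3)]
      by (blast intro: convex_imp_simply_connected contractible_imp_simply_connected convex_ball)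
    moreover have "C \<subseteq> ?U" "K \<subseteq> C"
      using K(2) KU a by (simp_all only: C_def connected_component_maximal connected_component_subset)
    moreover have "diameter S \<le> 3 * diameter K" if "S \<subseteq> C" for S
      using diameter_subset_ball[of S a "3/2 * diameter K"] that \<open>C \<subseteq> ?U\<close> d by auto
    ultimately show ?thesis
      by blast
  qed
  then obtain V where V: "K \<subseteq> V" "V \<subseteq> \<Omega>" "simply_connected V"
    "\<And>S. S \<subseteq> V \<Longrightarrow> diameter S \<le> 3 * diameter K"
    by blast
  obtain g where g: "continuous_on (cball 0 1) g" "g ` cball 0 1 \<subseteq> V" "\<And>x. x \<in> sphere 0 1 \<Longrightarrow> g x = f x"
    using simply_connected_circle_extension[of V f] V f by (auto simp: K_def)
  from g(1,3) order_trans[OF g(2) V(2)] V(4)[OF g(2)] show "\<exists>g. continuous_on (cball 0 1) g \<and> g ` cball 0 1 \<subseteq> \<Omega> \<and>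
            (\<forall>x\<in>sphere 0 1. g x = f x) \<and>
            diameter (g ` cball 0 1) \<le> 3 * diameter (f ` sphere 0 1)"
    unfolding K_def by blast
qed

section \<open>From fillings of loops and cycles back to simple connectivity\<close>

text \<open>A circle map that extends over the disk is null-homotopic, and a path connected set in
  which all circle maps are null-homotopic is simply connected.\<close>

lemma homotopically_imp_simply_connected:
  fixes \<Omega> :: "'a::real_normed_vector set"
  assumes "path_connected \<Omega>" "homotopically_1_bounded_turning C \<Omega>"
  shows "simply_connected \<Omega>"
proof (rule simply_connected_eq_homotopic_circlemaps3)
  fix f :: "complex \<Rightarrow> 'a"
  assume f: "continuous_on (sphere 0 1) f" "f ` sphere 0 1 \<subseteq> \<Omega>"
  obtain h :: "real^2 \<Rightarrow> complex" and k where h: "homeomorphism UNIV UNIV h k"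
    "\<And>x. norm (h x) = norm x" "\<And>y. norm (k y) = norm y"
    using planar_homeomorphism[where 'a="real^2"] by auto
  have cont: "continuous_on U h" "continuous_on W k" for U W
    using h(1) continuous_on_subset by (auto simp: homeomorphism_def)
  have "continuous_on (sphere 0 1) (f \<circ> h)"
    using f(1) cont h(2) by (intro continuous_on_compose) (auto elim!: continuous_on_subset)
  moreover have "(f \<circ> h) ` sphere 0 1 \<subseteq> \<Omega>"
    using f(2) h(2) by fastforce
  ultimately obtain g where g: "continuous_on (cball 0 1) g" "g ` cball 0 1 \<subseteq> \<Omega>"
    "\<forall>x\<in>sphere 0 1. g x = (f \<circ> h) x"
    using assms(2) unfolding homotopically_1_bounded_turning_def by metis
  have "continuous_on (cball 0 1) (g \<circ> k)"
    using g(1) cont h(3) by (intro continuous_on_compose) (auto elim!: continuous_on_subset)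
  moreover have "(g \<circ> k) ` cball 0 1 \<subseteq> \<Omega>"
    using g(2) h(3) by fastforce
  moreover have "\<forall>x\<in>sphere 0 1. (g \<circ> k) x = f x"
    using g(3) h by (simp add: homeomorphism_def)
  ultimately show "\<exists>a. homotopic_with_canon (\<lambda>h. True) (sphere 0 1) \<Omega> f (\<lambda>x. a)"
    using nullhomotopic_from_sphere_extension[of 0 1 \<Omega> f] by metis
qed (rule assms)

text \<open>This is the additive extension of \<open>w\<close> from generators to the free abelian
  group on them.\<close>

definition frag_eval :: "('s \<Rightarrow> complex) \<Rightarrow> ('s \<Rightarrow>\<^sub>0 int) \<Rightarrow> complex" where
  "frag_eval w c = (\<Sum>s\<in>Poly_Mapping.keys c. of_int (Poly_Mapping.lookup c s) * w s)"

lemma frag_eval_superset: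
  assumes "finite A" "Poly_Mapping.keys c \<subseteq> A"
  shows "frag_eval w c = (\<Sum>s\<in>A. of_int (Poly_Mapping.lookup c s) * w s)"
  unfolding frag_eval_def using assms
  by (intro sum.mono_neutral_left) (auto simp: in_keys_iff)

lemma frag_eval_0 [simp]: "frag_eval w 0 = 0"
  by (simp add: frag_eval_def)

lemma frag_eval_of [simp]: "frag_eval w (frag_of s) = w s"
  by (simp add: frag_eval_def)

lemma frag_eval_add: "frag_eval w (a + b) = frag_eval w a + frag_eval w b"
proof -
  let ?A = "Poly_Mapping.keys a \<union> Poly_Mapping.keys b"
  show ?thesis
    using frag_eval_superset[of ?A a w] frag_eval_superset[of ?A b w]
      frag_eval_superset[of ?A "a + b" w] Poly_Mapping.keys_add[of a b]
    by (simp add: lookup_add distrib_right sum.distrib)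
qed

lemma frag_eval_diff: "frag_eval w (a - b) = frag_eval w a - frag_eval w b"
  using frag_eval_add[of w "a - b" b] by simp

text \<open>The pair consists of the barycentric coordinates at vertices 1 and 2. With
  \<open>b = 0\<close> the same map parametrizes \<open>standard_simplex 1\<close> from vertex 0 to
  vertex 1.\<close>

definition triangle_point :: "real \<times> real \<Rightarrow> nat \<Rightarrow> real" where
  "triangle_point = (\<lambda>(a, b) i. if i = 0 then 1 - a - b else if i = 1 then a else if i = 2 then b else 0)"

definition unit_triangle :: "(real \<times> real) set" where
  "unit_triangle = {(a, b). 0 \<le> a \<and> 0 \<le> b \<and> a + b \<le> 1}"

lemma continuous_triangle_point: "continuous_on A triangle_point"
proof (rule continuous_on_coordinatewise_then_product)
  show "continuous_on A (\<lambda>x. triangle_point x i)" for i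
    unfolding triangle_point_def case_prod_unfold
    by (cases "i = 0"; cases "i = 1"; cases "i = 2") (auto intro!: continuous_intros)
qed

lemma triangle_point_in_simplex: "x \<in> unit_triangle \<Longrightarrow> triangle_point x \<in> standard_simplex 2"
  by (auto simp: unit_triangle_def triangle_point_def standard_simplex_def numeral_2_eq_2)

lemma edge_in_simplex: "0 \<le> t \<Longrightarrow> t \<le> 1 \<Longrightarrow> triangle_point (t, 0) \<in> standard_simplex 1"
  by (auto simp: triangle_point_def standard_simplex_def)

lemma convex_unit_triangle: "convex unit_triangle"
proof -
  have *: "unit_triangle = {x. 0 \<le> (1, 0) \<bullet> x} \<inter> {x. 0 \<le> (0, 1) \<bullet> x} \<inter> {x. (1, 1) \<bullet> x \<le> 1}"
    by (auto simp: unit_triangle_def)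
  show ?thesis
    unfolding * by (intro convex_Int convex_halfspace_le convex_halfspace_ge)
qed

text \<open>Face \<open>k\<close> omits vertex \<open>k\<close>, and each edge runs from its lower
  to its higher vertex. The bounds on \<open>t\<close> matter because \<open>singular_face\<close>
  is restricted to the standard simplex.\<close>

lemma singular_face_edges:
  assumes "0 \<le> t" "t \<le> 1"
  shows "singular_face 2 0 s (triangle_point (t, 0)) = s (triangle_point (1 - t, t))"
    "singular_face 2 1 s (triangle_point (t, 0)) = s (triangle_point (0, t))"
    "singular_face 2 2 s (triangle_point (t, 0)) = s (triangle_point (t, 0))"
proof -
  have "simplical_face 0 (triangle_point (t, 0)) = triangle_point (1 - t, t)"
    "simplical_face 1 (triangle_point (t, 0)) = triangle_point (0, t)"
    "simplical_face 2 (triangle_point (t, 0)) = triangle_point (t, 0)"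
    by (auto simp: simplical_face_def triangle_point_def fun_eq_iff)
  then show "singular_face 2 0 s (triangle_point (t, 0)) = s (triangle_point (1 - t, t))"
    "singular_face 2 1 s (triangle_point (t, 0)) = s (triangle_point (0, t))"
    "singular_face 2 2 s (triangle_point (t, 0)) = s (triangle_point (t, 0))"
    using edge_in_simplex[OF assms] by (simp_all add: singular_face_def)
qed

text \<open>The edge of a \<open>1\<close>-simplex need not be closed; winding numbers of arbitrary paths are still additive
  under concatenation.\<close>

definition simplex_winding :: "('a \<Rightarrow> complex) \<Rightarrow> complex \<Rightarrow> ((nat \<Rightarrow> real) \<Rightarrow> 'a) \<Rightarrow> complex" where
  "simplex_winding f z s = winding_number (\<lambda>t. f (s (triangle_point (t, 0)))) z"

text \<open>In the convex triangle, the path through vertices 0, 1, 2 is homotopic with fixed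
  endpoints to the edge from 0 to 2. Its image under \<open>f \<circ> s\<close> avoids
  \<open>z\<close>, so the winding numbers agree.\<close>

lemma simplex_winding_boundary_simplex:
  assumes s: "singular_simplex 2 (top_of_set \<Omega>) s" and f: "continuous_on \<Omega> f" "z \<notin> f ` \<Omega>"
  shows "simplex_winding f z (singular_face 2 1 s)
    = simplex_winding f z (singular_face 2 2 s) + simplex_winding f z (singular_face 2 0 s)"
proof -
  define F where "F = f \<circ> s \<circ> triangle_point"
  have cs: "continuous_on (standard_simplex 2) s" "s \<in> standard_simplex 2 \<rightarrow> \<Omega>"
    using s by (auto simp: singular_simplex_def euclidean_product_topology)
  have contF: "continuous_on unit_triangle F"
    unfolding F_def using cs f(1) triangle_point_in_simplex continuous_triangle_point
    by (intro continuous_on_compose) (force elim!: continuous_on_subset)+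
  have imF: "F \<in> unit_triangle \<rightarrow> -{z}"
    using cs(2) f(2) triangle_point_in_simplex unfolding F_def by fastforce
  let ?p = "linepath (0, 0) (1, 0) :: real \<Rightarrow> real \<times> real"
  let ?q = "linepath (1, 0) (0, 1) :: real \<Rightarrow> real \<times> real"
  let ?r = "linepath (0, 0) (0, 1) :: real \<Rightarrow> real \<times> real"
  have vert: "(0, 0) \<in> unit_triangle" "(1, 0) \<in> unit_triangle" "(0, 1) \<in> unit_triangle"
    by (auto simp: unit_triangle_def)
  then have im: "path_image ?p \<subseteq> unit_triangle" "path_image ?q \<subseteq> unit_triangle" "path_image ?r \<subseteq> unit_triangle"
    using convex_unit_triangle by (simp_all add: closed_segment_subset)
  then have "homotopic_paths unit_triangle (?p +++ ?q) ?r"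
    using convex_imp_simply_connected[OF convex_unit_triangle]
    by (simp add: simply_connected_eq_homotopic_paths path_image_join)
  then have "homotopic_paths (-{z}) (F \<circ> (?p +++ ?q)) (F \<circ> ?r)"
    using homotopic_paths_continuous_image contF imF by blast
  then have "winding_number (F \<circ> ?r) z = winding_number ((F \<circ> ?p) +++ (F \<circ> ?q)) z"
    using winding_number_homotopic_paths by (metis path_compose_join)
  also have "\<dots> = winding_number (F \<circ> ?p) z + winding_number (F \<circ> ?q) z"
  proof (rule winding_number_join)
    show "path (F \<circ> ?p)" "path (F \<circ> ?q)"
      using im contF by (auto intro!: path_continuous_image elim: continuous_on_subset)
    show "z \<notin> path_image (F \<circ> ?p)" "z \<notin> path_image (F \<circ> ?q)"
      using im imF by (force simp: path_image_compose)+
  qed (simp add: pathfinish_compose pathstart_compose)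
  finally have "winding_number (F \<circ> ?r) z = winding_number (F \<circ> ?p) z + winding_number (F \<circ> ?q) z" .
  moreover have "winding_number (F \<circ> ?p) z = simplex_winding f z (singular_face 2 2 s)"
    "winding_number (F \<circ> ?q) z = simplex_winding f z (singular_face 2 0 s)"
    "winding_number (F \<circ> ?r) z = simplex_winding f z (singular_face 2 1 s)"
    unfolding simplex_winding_def
    by (auto intro!: winding_number_cong simp: F_def singular_face_edges linepath_def simp del: One_nat_def)
  ultimately show ?thesis
    by simp
qed

text \<open>This is the cocycle property of the winding number: additivity reduces it to single
  simplices, where it is the triangle identity with the signs of the boundary.\<close>

lemma simplex_winding_boundary:
  assumes c: "singular_chain 2 (top_of_set \<Omega>) c" and f: "continuous_on \<Omega> f" "z \<notin> f ` \<Omega>"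
  shows "frag_eval (simplex_winding f z) (chain_boundary 2 c) = 0"
  using c unfolding singular_chain_def
proof (induction rule: frag_induction)
  case (one s)
  have "chain_boundary 2 (frag_of s) = frag_of (singular_face 2 0 s) - frag_of (singular_face 2 1 s)
      + frag_of (singular_face 2 2 s)"
    by (simp add: chain_boundary_of numeral_2_eq_2)
  then show ?case
    using simplex_winding_boundary_simplex[OF _ f, of s] one by (simp add: frag_eval_add frag_eval_diff)
qed (simp_all add: chain_boundary_diff frag_eval_diff)

lemma loop_singular_cycle:
  fixes \<gamma> :: "real \<Rightarrow> 'a::topological_space"
  assumes "path \<gamma>" "path_image \<gamma> \<subseteq> \<Omega>" "pathfinish \<gamma> = pathstart \<gamma>"
  shows "singular_relcycle 1 (top_of_set \<Omega>) {} (frag_of (\<lambda>x\<in>standard_simplex 1. \<gamma> (x 1)))"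
proof -
  let ?s = "\<lambda>x\<in>standard_simplex 1. \<gamma> (x 1)"
  have x1: "x 1 \<in> {0..1}" if "x \<in> standard_simplex 1" for x
    using that by (auto simp: standard_simplex_def)
  have "continuous_on (standard_simplex 1) (\<lambda>x. \<gamma> (x 1))"
    using x1 continuous_on_compose2[OF assms(1)[unfolded path_def]]
      continuous_on_subset[OF continuous_on_product_coordinates[of 1]] by (metis image_subsetI subset_UNIV)
  then have "continuous_on (standard_simplex 1) ?s"
    by (simp cong: continuous_on_cong)
  then have "singular_simplex 1 (top_of_set \<Omega>) ?s"
    using assms(2) x1 by (auto simp: singular_simplex_def euclidean_product_topology path_image_def)
  \<comment> \<open>Face 0 is the end point of the loop and face 1 its starting point, so closedness
    makes the boundary cancel.\<close>
  moreover have "singular_face 1 0 ?s = singular_face 1 1 ?s"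
  proof -
    have "singular_face 1 k ?s x = \<gamma> (simplical_face k x 1)" if "x \<in> standard_simplex 0" "k \<le> 1" for k x
      using simplical_face_in_standard_simplex[of 1 k x] that by (simp add: singular_face_def)
    moreover have "simplical_face 0 x 1 = 1" "simplical_face 1 x 1 = 0" if "x \<in> standard_simplex 0" for x
      using that by (auto simp: simplical_face_def standard_simplex_0)
    ultimately have "singular_face 1 0 ?s x = singular_face 1 1 ?s x" if "x \<in> standard_simplex 0" for x
      using assms(3) that by (simp add: pathfinish_def pathstart_def)
    then show ?thesis
      by (force simp: singular_face_def restrict_def fun_eq_iff)
  qed
  then have "chain_boundary 1 (frag_of ?s) = 0"
    by (simp add: chain_boundary_of)
  ultimately show ?thesis
    by (simp add: singular_cycle singular_chain_of)
qed

lemma homologically_imp_simply_connected: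
  fixes \<Omega> :: "'a::euclidean_space set"
  assumes dim: "DIM('a) = 2" and "open \<Omega>" "connected \<Omega>" "homologically_1_bounded_turning C \<Omega>"
  shows "simply_connected \<Omega>"
proof -
  obtain h :: "'a \<Rightarrow> complex" and k where h: "homeomorphism UNIV UNIV h k"
    using planar_homeomorphism[OF dim] by metis
  have hO: "homeomorphism \<Omega> (h ` \<Omega>) h k"
    using homeomorphism_of_subsets[OF h] by blast
  have "winding_number g z = 0"
    if g: "path g" "path_image g \<subseteq> h ` \<Omega>" "pathfinish g = pathstart g" and z: "z \<notin> h ` \<Omega>" for g z
  proof -
    let ?\<gamma> = "k \<circ> g"
    let ?s = "\<lambda>x\<in>standard_simplex 1. ?\<gamma> (x 1)"
    have "path ?\<gamma>"
      using g(1) h continuous_on_subset by (metis homeomorphism_def path_continuous_image subset_UNIV)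
    moreover have "path_image ?\<gamma> \<subseteq> \<Omega>"
      using g(2) hO by (auto simp: path_image_compose homeomorphism_def)
    ultimately have "singular_relcycle 1 (top_of_set \<Omega>) {} (frag_of ?s)"
      using g(3) loop_singular_cycle[of ?\<gamma> \<Omega>] by (simp add: pathfinish_compose pathstart_compose)
    then obtain c where c: "singular_chain 2 (top_of_set \<Omega>) c" "chain_boundary 2 c = frag_of ?s"
      using assms(4) unfolding homologically_1_bounded_turning_def by blast
    have "simplex_winding h z ?s = 0"
      using simplex_winding_boundary[OF c(1) homeomorphism_cont1[OF hO] z] c(2) by simp
    moreover have "simplex_winding h z ?s = winding_number g z"
      unfolding simplex_winding_def
    proof (rule winding_number_cong)
      fix t :: real assume t: "0 \<le> t" "t \<le> 1"
      then show "h (?s (triangle_point (t, 0))) = g t"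
        using edge_in_simplex[OF t] h by (simp add: triangle_point_def homeomorphism_def)
    qed
    ultimately show ?thesis
      by simp
  qed
  moreover have "open (h ` \<Omega>)" "connected (h ` \<Omega>)"
    using assms(2,3) homeomorphism_imp_open_map[OF h] hO
    by (auto intro: connected_continuous_image homeomorphism_cont1)
  ultimately have "simply_connected (h ` \<Omega>)"
    using simply_connected_eq_winding_number_zero by blast
  then show ?thesis
    using hO homeomorphic_def homeomorphic_simply_connected_eq by metis
qed

theorem proposition4p6:
  shows "(\<forall>\<Omega> :: (real^2) set. is_domain \<Omega> \<longrightarrow>
            ((\<exists>C\<ge>1. homotopically_1_bounded_turning C \<Omega>) \<longleftrightarrow>
             (\<exists>C'\<ge>1. homologically_1_bounded_turning C' \<Omega>)))
       \<and> (\<forall>C\<ge>1. \<exists>C'\<ge>1. \<forall>\<Omega> :: (real^2) set. is_domain \<Omega> \<longrightarrow>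
            homotopically_1_bounded_turning C \<Omega> \<longrightarrow> homologically_1_bounded_turning C' \<Omega>)
       \<and> (\<forall>C'\<ge>1. \<exists>C\<ge>1. \<forall>\<Omega> :: (real^2) set. is_domain \<Omega> \<longrightarrow>
            homologically_1_bounded_turning C' \<Omega> \<longrightarrow> homotopically_1_bounded_turning C \<Omega>)"
proof -
  have A: "homologically_1_bounded_turning 3 \<Omega>"
    if "is_domain \<Omega>" "homotopically_1_bounded_turning C \<Omega>" for \<Omega> :: "(real^2) set" and C
    using that homotopically_imp_simply_connected[of \<Omega> C] simply_connected_imp_homologically[of \<Omega>]
    by (simp add: is_domain_def connected_open_path_connected)
  have B: "homotopically_1_bounded_turning 3 \<Omega>"
    if "is_domain \<Omega>" "homologically_1_bounded_turning C \<Omega>" for \<Omega> :: "(real^2) set" and C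
    using that homologically_imp_simply_connected[of \<Omega> C] simply_connected_imp_homotopically[of \<Omega>]
    by (simp add: is_domain_def)
  \<comment> \<open>The value 3 is the witness for every existential constant, whatever constant is
    given on the other side.\<close>
  have "(1::real) \<le> 3"
    by simp
  then show ?thesis
    using A B by meson
qed

end
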